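(* Let $(\mathcal{P},\mathcal{L},R)$ be a planar connection structure satisfying Axioms I-1, I-2, I-2bis and I-3 below. Then two distinct lines have one or no points in common. Equivalently, if two lines $a,a'\in\mathcal{L}$ have two distinct points in common, then $a=a'$.
   Context: A planar connection structure $(\mathcal{P},\mathcal{L},R)$ consists of a collection $\mathcal{P}$ of objects called points, a collection $\mathcal{L}$ of objects called lines (lines are not assumed to be sets of points), and a relation $R$ between unordered pairs $\{A,B\}$ of distinct points and lines $a$. When $R(\{A,B\},a)$ holds, one says that the line $a$ corresponds to the two points $A$ and $B$. A point $A$ is said to be a point of a line $a$ (equivalently, $A$ belongs to $a$, or $a$ goes through $A$) if there exists a point $B\neq A$ such that $a$ corresponds to $A$ and $B$. A point that is a point of both $a$ and $a'$ is called a point in common of $a$ and $a'$. Axiom I-1: for any two distinct points $A,B$ there exists a line that corresponds to $A$ and $B$. Axiom I-2: for any two distinct points $A,B$ there is only one line that corresponds to $A$ and $B$. Axiom I-2bis: if a line $a$ corresponds to $A$ and $C$, and also to $B$ and $D$, and if $A$ and $B$ are distinct points, then $a$ also corresponds to $A$ and $B$. Axiom I-3: every line goes through at least two distinct points; and there exist three distinct points such that no single line goes through all three of them. *)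

theory Defs
  imports Main
begin

text \<open>
  The points are the elements of \<open>P\<close>, the lines the elements of \<open>L\<close>; lines are not sets of
  points. An unordered pair of distinct points is a set \<open>{A, B}\<close> with \<open>A \<noteq> B\<close>, so
  \<open>R {A, B} a\<close> reads ``the line \<open>a\<close> corresponds to \<open>A\<close> and \<open>B\<close>''. The condition below says
  that \<open>R\<close> relates nothing but such pairs to lines; in particular \<open>R {A, A} a\<close> never holds.
\<close>

definition planar_connection_structure ::
    "'p set \<Rightarrow> 'l set \<Rightarrow> ('p set \<Rightarrow> 'l \<Rightarrow> bool) \<Rightarrow> bool" where
  "planar_connection_structure P L R \<longleftrightarrow>
     (\<forall>s a. R s a \<longrightarrow> a \<in> L \<and> (\<exists>A\<in>P. \<exists>B\<in>P. A \<noteq> B \<and> s = {A, B}))"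

definition point_of_line :: "'p set \<Rightarrow> ('p set \<Rightarrow> 'l \<Rightarrow> bool) \<Rightarrow> 'p \<Rightarrow> 'l \<Rightarrow> bool" where
  "point_of_line P R A a \<longleftrightarrow> A \<in> P \<and> (\<exists>B\<in>P. B \<noteq> A \<and> R {A, B} a)"

definition common_points :: "'p set \<Rightarrow> ('p set \<Rightarrow> 'l \<Rightarrow> bool) \<Rightarrow> 'l \<Rightarrow> 'l \<Rightarrow> 'p set" where
  "common_points P R a a' = {A \<in> P. point_of_line P R A a \<and> point_of_line P R A a'}"

definition axiom_I_1 :: "'p set \<Rightarrow> 'l set \<Rightarrow> ('p set \<Rightarrow> 'l \<Rightarrow> bool) \<Rightarrow> bool" where
  "axiom_I_1 P L R \<longleftrightarrow> (\<forall>A\<in>P. \<forall>B\<in>P. A \<noteq> B \<longrightarrow> (\<exists>a\<in>L. R {A, B} a))"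

definition axiom_I_2 :: "'p set \<Rightarrow> 'l set \<Rightarrow> ('p set \<Rightarrow> 'l \<Rightarrow> bool) \<Rightarrow> bool" where
  "axiom_I_2 P L R \<longleftrightarrow>
     (\<forall>A\<in>P. \<forall>B\<in>P. A \<noteq> B \<longrightarrow>
        (\<forall>a\<in>L. \<forall>b\<in>L. R {A, B} a \<longrightarrow> R {A, B} b \<longrightarrow> a = b))"

text \<open>
  Besides \<open>A \<noteq> C\<close> and \<open>B \<noteq> D\<close>, without which the two correspondences make no sense, only
  \<open>A \<noteq> B\<close> is required: other coincidences among the four points, such as \<open>C = D\<close>, are allowed.
\<close>

definition axiom_I_2bis :: "'p set \<Rightarrow> 'l set \<Rightarrow> ('p set \<Rightarrow> 'l \<Rightarrow> bool) \<Rightarrow> bool" where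
  "axiom_I_2bis P L R \<longleftrightarrow>
     (\<forall>a\<in>L. \<forall>A\<in>P. \<forall>B\<in>P. \<forall>C\<in>P. \<forall>D\<in>P.
        A \<noteq> C \<longrightarrow> B \<noteq> D \<longrightarrow> R {A, C} a \<longrightarrow> R {B, D} a \<longrightarrow> A \<noteq> B \<longrightarrow> R {A, B} a)"

definition axiom_I_3 :: "'p set \<Rightarrow> 'l set \<Rightarrow> ('p set \<Rightarrow> 'l \<Rightarrow> bool) \<Rightarrow> bool" where
  "axiom_I_3 P L R \<longleftrightarrow>
     (\<forall>a\<in>L. \<exists>A\<in>P. \<exists>B\<in>P. A \<noteq> B \<and> point_of_line P R A a \<and> point_of_line P R B a) \<and>
     (\<exists>A\<in>P. \<exists>B\<in>P. \<exists>C\<in>P. A \<noteq> B \<and> A \<noteq> C \<and> B \<noteq> C \<and>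
        \<not> (\<exists>a\<in>L. point_of_line P R A a \<and> point_of_line P R B a \<and> point_of_line P R C a))"

end

theory Submission
  imports Defs
begin

text \<open>Lying on a line only provides, for each point, some partner with which the line
  corresponds to it. Axiom I-2bis exchanges these partners: if \<open>a\<close> goes through
  distinct \<open>A\<close> and \<open>B\<close>, then \<open>a\<close> corresponds to the pair
  \<open>{A, B}\<close> itself (\<open>line_corresponds_to_its_points\<close>). Hence two lines
  sharing two distinct points both correspond to that one pair, and I-2 identifies them.\<close>

lemma line_corresponds_to_its_points:
  assumes "axiom_I_2bis P L R" and "a \<in> L"
    and "point_of_line P R A a" and "point_of_line P R B a" and "A \<noteq> B"
  shows "R {A, B} a"
proof -
  obtain C where "A \<in> P" "C \<in> P" "A \<noteq> C" "R {A, C} a"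
    using assms(3) unfolding point_of_line_def by blast
  moreover obtain D where "B \<in> P" "D \<in> P" "B \<noteq> D" "R {B, D} a"
    using assms(4) unfolding point_of_line_def by blast
  \<comment> \<open>The partners may coincide, or \<open>C\<close> may be \<open>B\<close> or
    \<open>D\<close> be \<open>A\<close>; I-2bis allows all this, so no case split arises.\<close>
  ultimately show ?thesis
    using assms(1,2,5) unfolding axiom_I_2bis_def by blast
qed

theorem theorem1:
  fixes P :: "'p set" and L :: "'l set" and R :: "'p set \<Rightarrow> 'l \<Rightarrow> bool"
  assumes "planar_connection_structure P L R"
    and "axiom_I_1 P L R"
    and "axiom_I_2 P L R"
    and "axiom_I_2bis P L R"
    and "axiom_I_3 P L R"
  shows "(\<forall>a\<in>L. \<forall>a'\<in>L. a \<noteq> a' \<longrightarrow>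
            common_points P R a a' = {} \<or> (\<exists>A. common_points P R a a' = {A})) \<and>
         (\<forall>a\<in>L. \<forall>a'\<in>L.
            (\<exists>A\<in>common_points P R a a'. \<exists>B\<in>common_points P R a a'. A \<noteq> B) \<longrightarrow> a = a')"
proof -
  have unique: "a = a'"
    if "a \<in> L" "a' \<in> L" "A \<in> common_points P R a a'" "B \<in> common_points P R a a'" "A \<noteq> B"
    for a a' A B
  proof -
    have "R {A, B} a" "R {A, B} a'"
      using that line_corresponds_to_its_points[OF assms(4)]
      unfolding common_points_def by blast+
    moreover have "A \<in> P" "B \<in> P"
      using that unfolding common_points_def by blast+
    ultimately show ?thesis
      using assms(3) that unfolding axiom_I_2_def by blast
  qed
  \<comment> \<open>Contrapositive of \<open>unique\<close>: a set without two distinct elements is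
    empty or a singleton.\<close>
  then have "common_points P R a a' = {} \<or> (\<exists>A. common_points P R a a' = {A})"
    if "a \<in> L" "a' \<in> L" "a \<noteq> a'" for a a'
    using that by blast
  with unique show ?thesis by blast
qed

end
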